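(* Let $H=H(b,\delta,\lambda)$ be a balanced HST, let $W$ be a random $n$-element submultiset of its leaves, and let $h=\min(\delta,\log_b n)$. Then there exist positive constants $A'_{b,\lambda}$ and $B'_{b,\lambda}$, depending only on $b$ and $\lambda$, such that \[A'_{b,\lambda}\sum_{k=1}^{h}(b\lambda)^k\;\le\;\mathbf{E}[M(W)]\;\le\;B'_{b,\lambda}\sum_{k=1}^{h}(b\lambda)^k .\]
   Context: A balanced HST $H(b,\delta,\lambda)$ (integers $b\ge2$, $\delta\ge1$, real $0<\lambda<1$) is a rooted tree in which every non-leaf vertex has exactly $b$ children and every leaf is at depth $\delta$; the root is at level $0$, and each edge joining a vertex at level $\ell-1$ to a child at level $\ell$ has weight $\lambda^\ell$. The distance $d_H(x,y)$ is the total weight of the tree path between $x$ and $y$. A random $n$-element submultiset of the leaves is obtained by choosing $n$ leaves independently and uniformly at random (repetitions allowed); copies of the same leaf are treated as distinct points at distance $0$. For a finite multiset $V$ of leaves, $M(V)$ is the minimum of $\sum d_H(x,y)$ over all perfect matchings of the complete graph on $V$ (sum over matched pairs); if $|V|$ is odd, $M(V)$ is the minimum of $M(V\setminus\{x\})$ over $x\in V$. The sum $\sum_{k=1}^{h}$ ranges over integers $k$ with $1\le k\le h$.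
   Formalization: The upper bound is not claimed for 2 ≤ n < b, where the sum is empty but E[M(W)] > 0; the lower bound is not claimed for b = 2, δ = 1 and odd n ≥ 3, where M(W) = 0 always but the sum is 2λ > 0. Also n ≥ 1 is assumed so that log_b n is defined. *)

theory Defs
  imports "HOL-Probability.Probability"
begin

text \<open>
  The balanced HST is modelled concretely: a vertex is the list of child indices (each below
  \<open>b\<close>) chosen on the way down from the root, most recent choice first. So the root is \<open>[]\<close>, the
  children of \<open>v\<close> are the lists \<open>i # v\<close>, and the level of \<open>v\<close> is \<open>length v\<close>.
\<close>

definition hst_vertices :: "nat \<Rightarrow> nat \<Rightarrow> nat list set" where
  "hst_vertices b \<delta> = {v. set v \<subseteq> {..<b} \<and> length v \<le> \<delta>}"

definition hst_leaves :: "nat \<Rightarrow> nat \<Rightarrow> nat list set" where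
  "hst_leaves b \<delta> = {v. set v \<subseteq> {..<b} \<and> length v = \<delta>}"

definition hst_adj :: "nat list \<Rightarrow> nat list \<Rightarrow> bool" where
  "hst_adj u v \<longleftrightarrow> (\<exists>i. v = i # u) \<or> (\<exists>i. u = i # v)"

definition hst_weight :: "real \<Rightarrow> nat list \<Rightarrow> nat list \<Rightarrow> real" where
  "hst_weight lam u v = lam ^ max (length u) (length v)"

definition hst_path :: "nat \<Rightarrow> nat \<Rightarrow> nat list \<Rightarrow> nat list \<Rightarrow> nat list list \<Rightarrow> bool" where
  "hst_path b \<delta> x y p \<longleftrightarrow>
     p \<noteq> [] \<and> hd p = x \<and> last p = y \<and> distinct p \<and> set p \<subseteq> hst_vertices b \<delta> \<and> successively hst_adj p"

definition path_weight :: "real \<Rightarrow> nat list list \<Rightarrow> real" where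
  "path_weight lam p = (\<Sum>i<length p - 1. hst_weight lam (p ! i) (p ! Suc i))"

definition hst_dist :: "nat \<Rightarrow> nat \<Rightarrow> real \<Rightarrow> nat list \<Rightarrow> nat list \<Rightarrow> real" where
  "hst_dist b \<delta> lam x y = path_weight lam (THE p. hst_path b \<delta> x y p)"

text \<open>
  A finite multiset of points is given as a family \<open>x\<close> over a finite index set \<open>I\<close>, so that repeated
  points remain distinct vertices of the complete graph. A matching is a set of two-element subsets
  of \<open>I\<close>; \<open>d\<close> is meant to be symmetric, so the order in which \<open>Min\<close> and \<open>Max\<close> list the two ends
  of an edge is immaterial.
\<close>

definition perfect_matching :: "nat set \<Rightarrow> nat set set \<Rightarrow> bool" where
  "perfect_matching I P \<longleftrightarrow> partition_on I P \<and> (\<forall>e\<in>P. card e = 2)"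

definition matching_cost :: "('a \<Rightarrow> 'a \<Rightarrow> real) \<Rightarrow> (nat \<Rightarrow> 'a) \<Rightarrow> nat set set \<Rightarrow> real" where
  "matching_cost d x P = (\<Sum>e\<in>P. d (x (Min e)) (x (Max e)))"

definition min_perfect_matching :: "('a \<Rightarrow> 'a \<Rightarrow> real) \<Rightarrow> nat set \<Rightarrow> (nat \<Rightarrow> 'a) \<Rightarrow> real" where
  "min_perfect_matching d I x = Min (matching_cost d x ` {P. perfect_matching I P})"

definition min_matching :: "('a \<Rightarrow> 'a \<Rightarrow> real) \<Rightarrow> nat set \<Rightarrow> (nat \<Rightarrow> 'a) \<Rightarrow> real" where
  "min_matching d I x =
     (if even (card I) then min_perfect_matching d I x
      else Min ((\<lambda>i. min_perfect_matching d (I - {i}) x) ` I))"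

definition random_leaves :: "nat \<Rightarrow> nat \<Rightarrow> nat \<Rightarrow> (nat \<Rightarrow> nat list) pmf" where
  "random_leaves b \<delta> n = Pi_pmf {..<n} undefined (\<lambda>_. pmf_of_set (hst_leaves b \<delta>))"

definition expected_matching :: "nat \<Rightarrow> nat \<Rightarrow> real \<Rightarrow> nat \<Rightarrow> real" where
  "expected_matching b \<delta> lam n =
     measure_pmf.expectation (random_leaves b \<delta> n) (\<lambda>W. min_matching (hst_dist b \<delta> lam) {..<n} W)"

text \<open>
  Two degenerate ranges of the parameters: for \<open>2 \<le> n < b\<close> the sum below is empty although the
  expected cost is positive, and for \<open>b = 2\<close>, \<open>\<delta> = 1\<close> and odd \<open>n\<close> the cost is always zero (discard a
  point from the leaf chosen an odd number of times) although the sum is positive once \<open>n \<ge> 3\<close>.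
\<close>

definition hst_sum :: "nat \<Rightarrow> nat \<Rightarrow> real \<Rightarrow> nat \<Rightarrow> real" where
  "hst_sum b \<delta> lam n =
     (let h = min (real \<delta>) (log (real b) (real n))
      in \<Sum>k | 1 \<le> k \<and> real k \<le> h. (real b * lam) ^ k)"

end

theory Submission
  imports Defs
begin

text \<open>
  Let \<open>O\<^sub>l\<close> be the number of level-\<open>l\<close> vertices with an odd number of points below them. A matching
  must send at least one point out of each such vertex, and greedily matching closest pairs sends
  out no more, so \<open>M(W)\<close> is exactly the sum of \<open>\<lambda>\<^sup>l (O\<^sub>l - (n mod 2))\<close> over the levels \<open>l \<ge> 1\<close>.
  With \<open>m = b\<^sup>l\<close>, the expectation of \<open>O\<^sub>l\<close> is \<open>m (1 - (1 - 2/m)\<^sup>n) / 2\<close>, because the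
  number \<open>c\<close> of points below a fixed vertex is binomial, whence \<open>(-1)\<^sup>c\<close> has mean \<open>(1 - 2/m)\<^sup>n\<close>. This is of
  order \<open>m\<close> as long as \<open>m \<le> n\<close>, and at most \<open>n\<close> beyond, where the weights \<open>\<lambda>\<^sup>l\<close> decay geometrically.
\<close>

subsection \<open>Distances between leaves\<close>

text \<open>\<open>suffix (i # u) w\<close> says that \<open>w\<close> lies in the subtree rooted at
  \<open>i # u\<close>. The only edge leaving that subtree joins \<open>i # u\<close> to its parent
  \<open>u\<close>, so an edge avoiding \<open>u\<close> cannot cross its boundary.\<close>

lemma hst_adj_suffix_iff:
  assumes "hst_adj w w'" "w \<noteq> u" "w' \<noteq> u"
  shows "suffix (i # u) w \<longleftrightarrow> suffix (i # u) w'"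
  using assms by (auto simp: hst_adj_def suffix_Cons)

lemma successively_adj_suffix_iff:
  assumes "successively hst_adj p" "u \<notin> set p" "w \<in> set p"
  shows "suffix (i # u) w \<longleftrightarrow> suffix (i # u) (hd p)"
  using assms
proof (induction p arbitrary: w)
  case (Cons a p)
  show ?case
  proof (cases "w = a")
    case False
    then have p: "w \<in> set p" "p \<noteq> []" using Cons.prems by auto
    then have "hst_adj a (hd p)" "successively hst_adj p" "hd p \<in> set p"
      using Cons.prems by (auto simp: successively_Cons)
    then have "suffix (i # u) a \<longleftrightarrow> suffix (i # u) (hd p)"
      using Cons.prems by (intro hst_adj_suffix_iff) auto
    then show ?thesis
      using Cons.IH[of w] Cons.prems p \<open>successively hst_adj p\<close> by simp
  qed simp
qed simp

text \<open>
  Uniqueness of simple paths: after leaving \<open>x\<close>, a simple path can no longer enter or leave the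
  subtree of a child of \<open>x\<close>, so its target determines its second vertex.
\<close>

lemma path_second_vertex:
  assumes "successively hst_adj (x # v # p)" "distinct (x # v # p)" "last (x # v # p) = y"
  shows "v = (if \<exists>i. suffix (i # x) y then (SOME i. suffix (i # x) y) # x else tl x)"
proof -
  have "y \<in> set (v # p)" using assms(3) last_in_set[of "v # p"] by simp
  then have stay: "suffix (i # x) y \<longleftrightarrow> suffix (i # x) v" for i
    using successively_adj_suffix_iff[of "v # p" x y i] assms(1,2) by simp
  have no_suffix: "\<not> suffix (i # z) z" "\<not> suffix (j # i # z) z" for i j and z :: "nat list"
    by (auto dest: suffix_length_le)
  have "(\<exists>i. v = i # x) \<or> (\<exists>i. x = i # v)"
    using assms(1) by (simp add: hst_adj_def)
  then show ?thesis
  proof (elim disjE exE)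
    fix i assume v: "v = i # x"
    then show ?thesis unfolding stay by (simp add: suffix_Cons no_suffix)
  next
    fix i assume "x = i # v"
    then show ?thesis unfolding stay by (simp add: no_suffix)
  qed
qed

lemma simple_path_unique:
  assumes "successively hst_adj (x # p)" "distinct (x # p)" "last (x # p) = y"
    and "successively hst_adj (x # q)" "distinct (x # q)" "last (x # q) = y"
  shows "p = q"
  using assms
proof (induction p arbitrary: x q)
  case Nil
  have "q = []"
  proof (rule ccontr)
    assume "q \<noteq> []"
    then have "x \<in> set q" using Nil.prems(3,6) last_in_set[of q] by simp
    then show False using Nil.prems(5) by simp
  qed
  then show ?case by simp
next
  case (Cons v p)
  show ?case
  proof (cases q)
    case Nil
    then have "x \<in> set (v # p)" using Cons.prems(3,6) last_in_set[of "v # p"] by simp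
    then show ?thesis using Cons.prems(2) by simp
  next
    case q: (Cons v' q')
    have v: "v = v'"
      using path_second_vertex[OF Cons.prems(1-3)] path_second_vertex[OF Cons.prems(4-6)[unfolded q]]
      by (rule trans[OF _ sym])
    have "p = q'"
    proof (rule Cons.IH)
      show "successively hst_adj (v # q')" "distinct (v # q')" "last (v # q') = y"
        using Cons.prems(4-6) unfolding q v by simp_all
      show "successively hst_adj (v # p)" "distinct (v # p)" "last (v # p) = y"
        using Cons.prems(1-3) by simp_all
    qed
    then show ?thesis unfolding q v by (rule arg_cong)
  qed
qed

lemma hst_path_unique:
  assumes "hst_path b \<delta> x y p" "hst_path b \<delta> x y q"
  shows "p = q"
  using assms simple_path_unique[of x "tl p" y "tl q"]
  by (cases p; cases q) (auto simp: hst_path_def)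

lemma path_weight_Cons:
  "p \<noteq> [] \<Longrightarrow> path_weight lam (x # p) = hst_weight lam x (hd p) + path_weight lam p"
  by (cases p) (simp_all add: path_weight_def sum.lessThan_Suc_shift del: sum.lessThan_Suc)

lemma path_weight_snoc:
  assumes "p \<noteq> []"
  shows "path_weight lam (p @ [y]) = path_weight lam p + hst_weight lam (last p) y"
proof -
  obtain m where m: "length p = Suc m" using assms by (cases p) auto
  have "(\<Sum>i<m. hst_weight lam ((p @ [y]) ! i) ((p @ [y]) ! Suc i))
      = (\<Sum>i<m. hst_weight lam (p ! i) (p ! Suc i))"
    by (rule sum.cong) (use m in \<open>auto simp: nth_append\<close>)
  then show ?thesis
    using assms m by (simp add: path_weight_def nth_append last_conv_nth)
qed

text \<open>Induction on the common level \<open>k\<close>: step from both ends to their parents and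
  join these by the path already built. A level contributes its two edges exactly when the ancestors
  there differ. The bound on the lengths along \<open>p\<close> is carried along to keep the
  extended path simple.\<close>

lemma hst_path_exists:
  assumes "length x = k" "length y = k" "set x \<subseteq> {..<b}" "set y \<subseteq> {..<b}" "k \<le> \<delta>"
  shows "\<exists>p. hst_path b \<delta> x y p \<and> (\<forall>v\<in>set p. length v \<le> k) \<and>
    path_weight lam p =
      (\<Sum>l=1..k. 2 * lam ^ l * of_bool (drop (k - l) x \<noteq> drop (k - l) y))"
  using assms
proof (induction k arbitrary: x y)
  case 0
  then show ?case
    by (intro exI[of _ "[[]]"]) (auto simp: hst_path_def hst_vertices_def path_weight_def)
next
  case (Suc k)
  show ?case
  proof (cases "x = y")
    case True
    then show ?thesis using Suc.prems
      by (intro exI[of _ "[x]"]) (auto simp: hst_path_def hst_vertices_def path_weight_def)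
  next
    case False
    obtain i x' where x: "x = i # x'" using Suc.prems by (cases x) auto
    obtain j y' where y: "y = j # y'" using Suc.prems by (cases y) auto
    obtain p where p: "hst_path b \<delta> x' y' p" "\<forall>v\<in>set p. length v \<le> k"
      and pw: "path_weight lam p =
        (\<Sum>l=1..k. 2 * lam ^ l * of_bool (drop (k - l) x' \<noteq> drop (k - l) y'))"
      using Suc.IH[of x' y'] Suc.prems x y by auto
    have pne: "p \<noteq> []" "hd p = x'" "last p = y'" using p by (auto simp: hst_path_def)
    have "successively hst_adj (x # p @ [y])"
      using p pne x y by (auto simp: hst_path_def successively_append_iff successively_Cons hst_adj_def)
    \<comment> \<open>The new ends have length \<open>Suc k\<close>, whereas every vertex of
      \<open>p\<close> has length at most \<open>k\<close>.\<close>
    moreover have "distinct (x # p @ [y])"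
      using p False Suc.prems by (fastforce simp: hst_path_def)
    ultimately have "hst_path b \<delta> x y (x # p @ [y])"
      using p Suc.prems by (auto simp: hst_path_def hst_vertices_def)
    moreover have "path_weight lam (x # p @ [y]) = path_weight lam p + 2 * lam ^ Suc k"
      using pne x y Suc.prems by (simp add: path_weight_Cons path_weight_snoc hst_weight_def)
    moreover have "(\<Sum>l=1..Suc k. 2 * lam ^ l * of_bool (drop (Suc k - l) x \<noteq> drop (Suc k - l) y))
        = path_weight lam p + 2 * lam ^ Suc k"
    proof -
      have "(\<Sum>l=1..k. 2 * lam ^ l * of_bool (drop (Suc k - l) x \<noteq> drop (Suc k - l) y)) = path_weight lam p"
        unfolding pw by (rule sum.cong) (auto simp: x y Suc_diff_le)
      then show ?thesis using False by simp
    qed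
    moreover have "\<forall>v\<in>set (x # p @ [y]). length v \<le> Suc k"
      using p Suc.prems by auto
    ultimately show ?thesis by (intro exI[of _ "x # p @ [y]"]) auto
  qed
qed

lemma hst_dist_leaves:
  assumes "x \<in> hst_leaves b \<delta>" "y \<in> hst_leaves b \<delta>"
  shows "hst_dist b \<delta> lam x y =
    (\<Sum>l=1..\<delta>. 2 * lam ^ l * of_bool (drop (\<delta> - l) x \<noteq> drop (\<delta> - l) y))"
proof -
  obtain p where p: "hst_path b \<delta> x y p"
    and w: "path_weight lam p = (\<Sum>l=1..\<delta>. 2 * lam ^ l * of_bool (drop (\<delta> - l) x \<noteq> drop (\<delta> - l) y))"
    using hst_path_exists[of x \<delta> y b \<delta> lam] assms by (auto simp: hst_leaves_def)
  have "(THE p. hst_path b \<delta> x y p) = p"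
    using p hst_path_unique by (intro the_equality) auto
  then show ?thesis using w by (simp add: hst_dist_def)
qed

subsection \<open>Minimum matchings and parity\<close>

text \<open>With \<open>f\<close> sending a point to its level-\<open>l\<close> ancestor, the
  cardinality is \<open>O\<^sub>l\<close>. Empty classes have even size, so \<open>v\<close> may
  range over the whole type.\<close>

definition odd_classes :: "('i \<Rightarrow> 'b) \<Rightarrow> 'i set \<Rightarrow> 'b set" where
  "odd_classes f I = {v. odd (card {i\<in>I. f i = v})}"

lemma odd_classes_empty [simp]: "odd_classes f {} = {}"
  by (simp add: odd_classes_def)

lemma odd_classes_subset: "odd_classes f I \<subseteq> f ` I"
proof
  fix v assume "v \<in> odd_classes f I"
  then have "{i\<in>I. f i = v} \<noteq> {}" by (intro notI) (simp add: odd_classes_def)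
  then show "v \<in> f ` I" by auto
qed

lemma finite_odd_classes: "finite I \<Longrightarrow> finite (odd_classes f I)"
  using odd_classes_subset finite_surj by metis

text \<open>A new point flips the parity of its own class only.\<close>

lemma odd_classes_insert:
  assumes "finite I" "i \<notin> I"
  shows "odd_classes f (insert i I) =
    (if f i \<in> odd_classes f I then odd_classes f I - {f i} else insert (f i) (odd_classes f I))"
proof -
  have "v \<in> odd_classes f (insert i I) \<longleftrightarrow> (v \<in> odd_classes f I) \<noteq> (v = f i)" for v
  proof (cases "v = f i")
    case True
    then have "{k \<in> insert i I. f k = v} = insert i {k\<in>I. f k = v}" by auto
    then show ?thesis using assms True by (simp add: odd_classes_def)
  next
    case False
    then have "{k \<in> insert i I. f k = v} = {k\<in>I. f k = v}" by auto
    then show ?thesis using False by (simp add: odd_classes_def)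
  qed
  then show ?thesis by auto
qed

lemma card_odd_classes_insert:
  assumes "finite I" "i \<notin> I"
  shows "card (odd_classes f (insert i I)) \<le> card (odd_classes f I) + 1"
  using assms finite_odd_classes[of I f]
  by (auto simp: odd_classes_insert card_Diff_singleton card_insert_if)

lemma odd_classes_insert_pair:
  assumes "finite I" "i \<notin> I" "j \<notin> I" "i \<noteq> j" "f i = f j"
  shows "odd_classes f (insert i (insert j I)) = odd_classes f I"
  using assms by (auto simp: odd_classes_insert)

lemma card_odd_classes_insert_pair:
  assumes "finite I" "i \<notin> I" "j \<notin> I" "i \<noteq> j"
  shows "real (card (odd_classes f (insert i (insert j I))))
    \<le> real (card (odd_classes f I)) + 2 * of_bool (f i \<noteq> f j)"
proof (cases "f i = f j")
  case True
  then show ?thesis using odd_classes_insert_pair[OF assms True] by simp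
next
  case False
  have "card (odd_classes f (insert i (insert j I))) \<le> card (odd_classes f I) + 2"
    using card_odd_classes_insert[of "insert j I" i f] card_odd_classes_insert[of I j f] assms
    by simp
  then show ?thesis using False by simp
qed

lemma odd_classes_inj_on:
  assumes "inj_on f I"
  shows "odd_classes f I = f ` I"
proof -
  have "v \<in> odd_classes f I" if v: "v \<in> f ` I" for v
  proof -
    obtain i where i: "i \<in> I" "v = f i" using v by auto
    then have "{k\<in>I. f k = v} = {i}" using assms by (auto dest: inj_onD)
    then show ?thesis by (simp add: odd_classes_def)
  qed
  then show ?thesis using odd_classes_subset[of f I] by auto
qed

section \<open>Perfect matchings and their minimum cost\<close>

lemma perfect_matching_finite:
  "finite I \<Longrightarrow> finite {P. perfect_matching I P}"
  by (rule finite_subset[of _ "Pow (Pow I)"]) (auto simp: perfect_matching_def partition_on_def)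

lemma perfect_matching_empty: "perfect_matching {} P \<longleftrightarrow> P = {}"
  by (auto simp: perfect_matching_def partition_on_def)

lemma perfect_matching_insert:
  assumes "perfect_matching I P" "i \<notin> I" "j \<notin> I" "i \<noteq> j"
  shows "perfect_matching (insert i (insert j I)) (insert {i, j} P)"
  using assms by (auto simp: perfect_matching_def partition_on_def disjoint_def)

text \<open>Peel off the edges one at a time: an edge inside a class changes no parity, and an edge
  between two classes changes two parities.\<close>

lemma card_odd_classes_le_cut:
  fixes I :: "nat set"
  assumes "finite P" "perfect_matching I P" "finite I"
  shows "real (card (odd_classes f I)) \<le> (\<Sum>e\<in>P. 2 * of_bool (f (Min e) \<noteq> f (Max e)))"
  using assms
proof (induction P arbitrary: I)
  case empty
  then show ?case by (simp add: perfect_matching_def partition_on_def)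
next
  case (insert e P)
  then have "card e = 2" by (simp add: perfect_matching_def)
  then obtain i0 j0 where "e = {i0, j0}" "i0 \<noteq> j0" by (auto simp: card_2_iff)
  \<comment> \<open>The ends are ordered so that \<open>Min e\<close> is \<open>i\<close> and
    \<open>Max e\<close> is \<open>j\<close>.\<close>
  then obtain i j where e: "e = {i, j}" "i < j"
    by (metis insert_commute linorder_neqE_nat)
  have part: "I = e \<union> \<Union>P" "\<forall>e'\<in>P. e \<inter> e' = {}"
    using insert.prems insert.hyps by (auto simp: perfect_matching_def partition_on_def disjoint_def)
  then have ij: "i \<notin> \<Union>P" "j \<notin> \<Union>P" "I = insert i (insert j (\<Union>P))"
    using e by auto
  have "perfect_matching (\<Union>P) P"
    using insert.prems by (auto simp: perfect_matching_def partition_on_def disjoint_def)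
  moreover have fin: "finite (\<Union>P)" using insert.prems part by simp
  ultimately have "real (card (odd_classes f (\<Union>P))) \<le> (\<Sum>e\<in>P. 2 * of_bool (f (Min e) \<noteq> f (Max e)))"
    by (intro insert.IH)
  moreover have "real (card (odd_classes f I)) \<le> real (card (odd_classes f (\<Union>P))) + 2 * of_bool (f i \<noteq> f j)"
    unfolding ij(3) using fin ij e by (intro card_odd_classes_insert_pair) auto
  moreover have "(\<Sum>e\<in>insert e P. 2 * of_bool (f (Min e) \<noteq> f (Max e)) :: real)
      = 2 * of_bool (f i \<noteq> f j) + (\<Sum>e\<in>P. 2 * of_bool (f (Min e) \<noteq> f (Max e)))"
    using insert.hyps e by (subst sum.insert) auto
  ultimately show ?case by linarith
qed

text \<open>Abstracts the tree away: \<open>g l u\<close> stands for the level-\<open>l\<close>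
  ancestor and \<open>w l\<close> for the edge weight at that level. Two points pay both edges of
  each level that separates them, and deeper levels give finer partitions.\<close>

locale hierarchical_metric =
  fixes S :: "'a set" and d :: "'a \<Rightarrow> 'a \<Rightarrow> real" and g :: "nat \<Rightarrow> 'a \<Rightarrow> 'b"
    and w :: "nat \<Rightarrow> real" and \<delta> :: nat
  assumes dist: "u \<in> S \<Longrightarrow> v \<in> S \<Longrightarrow> d u v = (\<Sum>l=1..\<delta>. 2 * w l * of_bool (g l u \<noteq> g l v))"
    and refine: "u \<in> S \<Longrightarrow> v \<in> S \<Longrightarrow> l \<le> m \<Longrightarrow> m \<le> \<delta> \<Longrightarrow> g m u = g m v \<Longrightarrow> g l u = g l v"
    and weight_nonneg: "0 \<le> w l"
begin

text \<open>The closed form to be proved for the minimum. For odd \<open>card I\<close> the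
  subtracted 1 accounts for the discarded point, which removes at most one odd class per
  level.\<close>

definition parity_cost :: "nat set \<Rightarrow> (nat \<Rightarrow> 'a) \<Rightarrow> real" where
  "parity_cost I x =
     (\<Sum>l=1..\<delta>. w l * (real (card (odd_classes (\<lambda>i. g l (x i)) I)) - of_bool (odd (card I))))"

text \<open>Weighting the cut bound of each level by \<open>w l\<close> and exchanging the two sums
  collects, for each edge, exactly its distance.\<close>

lemma parity_cost_le_matching_cost:
  assumes "finite I" "perfect_matching I P" "x ` I \<subseteq> S"
  shows "(\<Sum>l=1..\<delta>. w l * card (odd_classes (\<lambda>i. g l (x i)) I)) \<le> matching_cost d x P"
proof -
  have finP: "finite P"
    using assms by (auto simp: perfect_matching_def partition_on_def intro: finite_UnionD)
  have ends: "x (Min e) \<in> S" "x (Max e) \<in> S" if "e \<in> P" for e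
  proof -
    have "e \<subseteq> I" "e \<noteq> {}" using assms(2) that by (auto simp: perfect_matching_def partition_on_def)
    moreover from this have "finite e" using assms(1) finite_subset by auto
    ultimately have "Min e \<in> I" "Max e \<in> I" using Min_in[of e] Max_in[of e] by blast+
    then show "x (Min e) \<in> S" "x (Max e) \<in> S" using assms(3) by auto
  qed
  have "(\<Sum>l=1..\<delta>. w l * card (odd_classes (\<lambda>i. g l (x i)) I))
      \<le> (\<Sum>l=1..\<delta>. w l * (\<Sum>e\<in>P. 2 * of_bool (g l (x (Min e)) \<noteq> g l (x (Max e)))))"
    using card_odd_classes_le_cut[OF finP assms(2,1)] weight_nonneg
    by (intro sum_mono mult_left_mono) auto
  also have "\<dots> = (\<Sum>e\<in>P. \<Sum>l=1..\<delta>. 2 * w l * of_bool (g l (x (Min e)) \<noteq> g l (x (Max e))))"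
    by (subst sum.swap) (simp add: sum_distrib_left mult_ac)
  also have "\<dots> = matching_cost d x P"
    unfolding matching_cost_def by (rule sum.cong) (simp_all add: ends dist)
  finally show ?thesis .
qed

text \<open>Take for \<open>m\<close> the deepest level at which two points share an ancestor. By
  refinement this pair agrees at all shallower levels too, and beyond \<open>m\<close> all points
  are separated. If no level from 1 on identifies two points, \<open>m\<close> is 0 and any pair
  will do.\<close>

lemma closest_pair:
  fixes x :: "nat \<Rightarrow> 'a"
  assumes "x ` I \<subseteq> S" "finite I" "2 \<le> card I"
  obtains i j m where "i \<in> I" "j \<in> I" "i < j"
    "\<And>l. 1 \<le> l \<Longrightarrow> l \<le> m \<Longrightarrow> l \<le> \<delta> \<Longrightarrow> g l (x i) = g l (x j)"
    "\<And>l. m < l \<Longrightarrow> l \<le> \<delta> \<Longrightarrow> inj_on (\<lambda>i. g l (x i)) I"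
proof -
  \<comment> \<open>Admitting \<open>m = 0\<close> unconditionally and bounding by
    \<open>\<delta>\<close> ensures that the greatest such \<open>m\<close> exists.\<close>
  define Q where "Q m \<longleftrightarrow> m \<le> \<delta> \<and> (m = 0 \<or> (\<exists>i\<in>I. \<exists>j\<in>I. i < j \<and> g m (x i) = g m (x j)))" for m
  define m where "m = (GREATEST m. Q m)"
  have "Q 0" by (simp add: Q_def)
  then have "Q m" unfolding m_def by (rule GreatestI_nat[of Q _ \<delta>]) (simp add: Q_def)
  have above: "\<not> Q l" if "m < l" for l
  proof
    assume "Q l"
    then have "l \<le> m" unfolding m_def by (rule Greatest_le_nat[of Q l \<delta>]) (simp add: Q_def)
    then show False using that by simp
  qed
  have "inj_on (\<lambda>i. g l (x i)) I" if "m < l" "l \<le> \<delta>" for l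
  proof (rule inj_onI)
    fix i j assume "i \<in> I" "j \<in> I" "g l (x i) = g l (x j)"
    then show "i = j" using above[OF that(1)] that(2) unfolding Q_def
      by (metis nat_neq_iff)
  qed
  moreover obtain i j where ij: "i \<in> I" "j \<in> I" "i < j" "m = 0 \<or> g m (x i) = g m (x j)"
  proof (cases "m = 0")
    case True
    obtain i where "i \<in> I" using assms(3) by fastforce
    have "card (I - {i}) \<noteq> 0" using assms \<open>i \<in> I\<close> by simp
    then obtain j where "j \<in> I" "j \<noteq> i" by (metis DiffE card.empty ex_in_conv singletonI)
    then show ?thesis using that True \<open>i \<in> I\<close> by (metis linorder_neqE_nat)
  next
    case False
    then show ?thesis using \<open>Q m\<close> that unfolding Q_def by blast
  qed
  moreover have "g l (x i) = g l (x j)" if "1 \<le> l" "l \<le> m" for l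
    using refine[of "x i" "x j" l m] ij assms that \<open>Q m\<close> by (auto simp: Q_def)
  ultimately show ?thesis using that by blast
qed

text \<open>Remove a closest pair and recurse; \<open>J\<close> collects the point left over when
  \<open>card I\<close> is odd. The cut bound is then attained at every level, because each removed
  pair either leaves all parities alone or consists of two singleton classes.\<close>

lemma greedy_matching:
  assumes "finite I" "x ` I \<subseteq> S"
  shows "\<exists>J P. J \<subseteq> I \<and> card J = of_bool (odd (card I)) \<and> perfect_matching (I - J) P \<and>
    matching_cost d x P = parity_cost I x"
  using assms
proof (induction "card I" arbitrary: I rule: less_induct)
  case less
  consider "card I = 0" | "card I = 1" | "2 \<le> card I" by linarith
  then show ?case
  proof cases
    case 1
    then have "I = {}" using less.prems by simp
    then show ?thesis
      by (intro exI[of _ "{}"]) (simp add: perfect_matching_empty parity_cost_def matching_cost_def)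
  next
    \<comment> \<open>The only point is discarded. It forms the single odd class of each level, so
      every term is 1 - 1.\<close>
    case 2
    then obtain i where "I = {i}" by (auto simp: card_1_singleton_iff)
    then show ?thesis
      by (intro exI[of _ I] exI[of _ "{}"])
        (simp add: perfect_matching_empty parity_cost_def matching_cost_def odd_classes_insert)
  next
    case 3
    obtain i j m where ij: "i \<in> I" "j \<in> I" "i < j"
      and below: "\<And>l. 1 \<le> l \<Longrightarrow> l \<le> m \<Longrightarrow> l \<le> \<delta> \<Longrightarrow> g l (x i) = g l (x j)"
      and above: "\<And>l. m < l \<Longrightarrow> l \<le> \<delta> \<Longrightarrow> inj_on (\<lambda>i. g l (x i)) I"
      using closest_pair[of x I] less.prems 3 by blast
    define K where "K = I - {i, j}"
    have I: "I = insert i (insert j K)" and K: "finite K" "i \<notin> K" "j \<notin> K" "x ` K \<subseteq> S"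
      using ij less.prems by (auto simp: K_def)
    have card: "card I = card K + 2" using I K ij by simp
    obtain J P where JP: "J \<subseteq> K" "card J = of_bool (odd (card K))"
      "perfect_matching (K - J) P" "matching_cost d x P = parity_cost K x"
      using less.hyps[of K] card K by auto
    have finP: "finite P"
      using JP(3) K(1) by (auto simp: perfect_matching_def partition_on_def intro: finite_UnionD)
    have new: "{i, j} \<notin> P"
      using JP(3) K by (auto simp: perfect_matching_def partition_on_def)
    \<comment> \<open>Up to level \<open>m\<close> the pair shares a class and changes no parity.
      Beyond \<open>m\<close> every occupied class is a singleton, so the pair accounts for exactly
      two odd classes.\<close>
    have "real (card (odd_classes (\<lambda>i. g l (x i)) I)) =
        card (odd_classes (\<lambda>i. g l (x i)) K) + 2 * of_bool (g l (x i) \<noteq> g l (x j))"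
      if l: "1 \<le> l" "l \<le> \<delta>" for l
    proof (cases "l \<le> m")
      case True
      then have "g l (x i) = g l (x j)" using below l by simp
      then show ?thesis unfolding I
        using odd_classes_insert_pair[of K i j "\<lambda>i. g l (x i)"] K ij by simp
    next
      case False
      then have inj: "inj_on (\<lambda>i. g l (x i)) I" using above l by simp
      then have injK: "inj_on (\<lambda>i. g l (x i)) K" by (rule inj_on_subset) (use I in auto)
      have "g l (x i) \<noteq> g l (x j)" using inj ij by (auto dest: inj_onD)
      then show ?thesis
        by (simp add: odd_classes_inj_on[OF inj] odd_classes_inj_on[OF injK] card_image[OF inj]
            card_image[OF injK] card)
    qed
    \<comment> \<open>\<open>I\<close> and \<open>K\<close> have sizes of equal parity, so the
      corrections cancel and the differences over the levels add up to the distance of the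
      pair.\<close>
    then have "parity_cost I x = parity_cost K x + d (x i) (x j)"
      using ij less.prems(2)
      by (subst dist) (auto simp: parity_cost_def card sum.distrib[symmetric] algebra_simps intro!: sum.cong)
    moreover have "matching_cost d x (insert {i, j} P) = d (x i) (x j) + matching_cost d x P"
      using finP new ij by (simp add: matching_cost_def)
    moreover have "I - J = insert i (insert j (K - J))" using JP(1) I K by auto
    then have "perfect_matching (I - J) (insert {i, j} P)"
      using perfect_matching_insert[OF JP(3)] K ij by simp
    ultimately show ?thesis
      using JP card I by (intro exI[of _ J] exI[of _ "insert {i, j} P"]) auto
  qed
qed

text \<open>Besides the cut bound this needs \<open>Min\<close> to range over a nonempty set; the
  greedy construction supplies a perfect matching.\<close>

lemma parity_cost_le_min_perfect_matching:
  assumes "finite I" "even (card I)" "x ` I \<subseteq> S"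
  shows "(\<Sum>l=1..\<delta>. w l * card (odd_classes (\<lambda>i. g l (x i)) I)) \<le> min_perfect_matching d I x"
proof -
  obtain J P where "card J = 0" "J \<subseteq> I" "perfect_matching (I - J) P"
    using greedy_matching[OF assms(1,3)] assms(2) by auto
  moreover from this have "J = {}" using assms(1) finite_subset card_0_eq by blast
  ultimately have "perfect_matching I P" by simp
  then have "min_perfect_matching d I x \<in> matching_cost d x ` {P. perfect_matching I P}"
    unfolding min_perfect_matching_def using perfect_matching_finite[OF assms(1)]
    by (intro Min_in) auto
  then show ?thesis using parity_cost_le_matching_cost[OF assms(1) _ assms(3)] by auto
qed

lemma min_perfect_matching_le:
  "finite I \<Longrightarrow> perfect_matching I P \<Longrightarrow> min_perfect_matching d I x \<le> matching_cost d x P"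
  unfolding min_perfect_matching_def using perfect_matching_finite[of I] by (intro Min_le) auto

lemma min_matching_eq_parity_cost:
  assumes "finite I" "x ` I \<subseteq> S"
  shows "min_matching d I x = parity_cost I x"
proof -
  obtain J P where JP: "J \<subseteq> I" "card J = of_bool (odd (card I))" "perfect_matching (I - J) P"
    "matching_cost d x P = parity_cost I x"
    using greedy_matching[OF assms] by blast
  show ?thesis
  proof (cases "even (card I)")
    case True
    then have "J = {}" using JP assms finite_subset by fastforce
    then have "min_perfect_matching d I x \<le> parity_cost I x"
      using min_perfect_matching_le[of I P x] JP assms by simp
    moreover have "parity_cost I x \<le> min_perfect_matching d I x"
      using parity_cost_le_min_perfect_matching[OF assms(1) True assms(2)] True
      by (simp add: parity_cost_def)
    ultimately show ?thesis using True by (simp add: min_matching_def)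
  next
    case False
    then obtain i where i: "J = {i}" "i \<in> I" using JP by (auto simp: card_1_singleton_iff)
    \<comment> \<open>Whichever point \<open>k\<close> is discarded, each level loses at most one
      odd class, which the subtracted 1 absorbs.\<close>
    have "parity_cost I x \<le> min_perfect_matching d (I - {k}) x" if k: "k \<in> I" for k
    proof -
      have "real (card (odd_classes (\<lambda>i. g l (x i)) I)) - 1
          \<le> card (odd_classes (\<lambda>i. g l (x i)) (I - {k}))" for l
        using card_odd_classes_insert[of "I - {k}" k "\<lambda>i. g l (x i)"] assms k
        by (simp add: insert_absorb)
      then have "parity_cost I x \<le> (\<Sum>l=1..\<delta>. w l * card (odd_classes (\<lambda>i. g l (x i)) (I - {k})))"
        unfolding parity_cost_def using False weight_nonneg
        by (intro sum_mono mult_left_mono) auto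
      also have "\<dots> \<le> min_perfect_matching d (I - {k}) x"
        using assms False k by (intro parity_cost_le_min_perfect_matching) auto
      finally show ?thesis .
    qed
    moreover have "min_perfect_matching d (I - {i}) x \<le> parity_cost I x"
      using min_perfect_matching_le[of "I - {i}" P x] JP assms i by simp
    ultimately have "Min ((\<lambda>i. min_perfect_matching d (I - {i}) x) ` I) = parity_cost I x"
      using assms(1) i by (intro Min_eqI) (force intro: antisym)+
    then show ?thesis using False by (simp add: min_matching_def)
  qed
qed

end

subsection \<open>Random leaves\<close>

lemma finite_hst_leaves: "finite (hst_leaves b \<delta>)"
  unfolding hst_leaves_def by (rule finite_lists_length_eq) simp

lemma card_hst_leaves: "card (hst_leaves b \<delta>) = b ^ \<delta>"
  unfolding hst_leaves_def by (subst card_lists_length_eq) simp_all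

lemma hst_leaves_nonempty: "2 \<le> b \<Longrightarrow> hst_leaves b \<delta> \<noteq> {}"
  using card_hst_leaves[of b \<delta>] by (metis card.empty not_numeral_le_zero power_eq_0_iff)

lemma drop_hst_leaves:
  "x \<in> hst_leaves b \<delta> \<Longrightarrow> l \<le> \<delta> \<Longrightarrow> drop (\<delta> - l) x \<in> hst_leaves b l"
  by (auto simp: hst_leaves_def dest: in_set_dropD)

text \<open>Since the most recent choice comes first, \<open>drop (\<delta> - l)\<close> yields the
  level-\<open>l\<close> ancestor, and a leaf below \<open>v\<close> is \<open>u @ v\<close> with
  \<open>u\<close> free.\<close>

lemma card_leaves_below:
  assumes "v \<in> hst_leaves b l" "l \<le> \<delta>"
  shows "card {x \<in> hst_leaves b \<delta>. drop (\<delta> - l) x = v} = b ^ (\<delta> - l)"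
proof -
  have "{x \<in> hst_leaves b \<delta>. drop (\<delta> - l) x = v} = (\<lambda>u. u @ v) ` hst_leaves b (\<delta> - l)"
  proof (intro equalityI subsetI)
    fix x assume x: "x \<in> {x \<in> hst_leaves b \<delta>. drop (\<delta> - l) x = v}"
    then have "x = take (\<delta> - l) x @ v" by (metis (mono_tags) append_take_drop_id mem_Collect_eq)
    moreover have "take (\<delta> - l) x \<in> hst_leaves b (\<delta> - l)"
      using x by (auto simp: hst_leaves_def dest: in_set_takeD)
    ultimately show "x \<in> (\<lambda>u. u @ v) ` hst_leaves b (\<delta> - l)" by blast
  qed (use assms in \<open>auto simp: hst_leaves_def\<close>)
  then show ?thesis by (simp add: card_image inj_on_def card_hst_leaves)
qed

lemma hierarchical_metric_hst:
  assumes "0 \<le> lam"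
  shows "hierarchical_metric (hst_leaves b \<delta>) (hst_dist b \<delta> lam) (\<lambda>l. drop (\<delta> - l)) (\<lambda>l. lam ^ l) \<delta>"
proof
  fix u v :: "nat list" and l m :: nat
  assume "l \<le> m" "m \<le> \<delta>" "drop (\<delta> - m) u = drop (\<delta> - m) v"
  moreover have "drop (\<delta> - l) z = drop (m - l) (drop (\<delta> - m) z)" for z :: "nat list"
    using \<open>l \<le> m\<close> \<open>m \<le> \<delta>\<close> by simp
  ultimately show "drop (\<delta> - l) u = drop (\<delta> - l) v" by metis
qed (use assms hst_dist_leaves in auto)

section \<open>Expected parities and expected cost\<close>

lemma expectation_prod_Pi_pmf_finite:
  fixes f :: "'i \<Rightarrow> 'a \<Rightarrow> real"
  assumes "finite A" "\<And>i. i \<in> A \<Longrightarrow> finite (set_pmf (p i))"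
  shows "measure_pmf.expectation (Pi_pmf A dflt p) (\<lambda>y. \<Prod>i\<in>A. f i (y i)) =
    (\<Prod>i\<in>A. measure_pmf.expectation (p i) (f i))"
proof -
  let ?M = "Pi_pmf A dflt p"
  have comp: "map_pmf (\<lambda>y. y i) ?M = p i" if "i \<in> A" for i
    using Pi_pmf_component[OF assms(1), of i dflt p] that by simp
  have "finite (set_pmf ?M)"
    using assms by (auto simp: set_Pi_pmf intro!: finite_PiE_dflt)
  then have int: "integrable (measure_pmf ?M) (\<lambda>y. f i (y i))" for i
    by (rule integrable_measure_pmf_finite)
  have "prob_space.indep_vars (measure_pmf ?M) (\<lambda>_. borel) (\<lambda>i y. f i (y i)) A"
    by (rule prob_space.indep_vars_compose2[OF prob_space_measure_pmf indep_vars_Pi_pmf[OF assms(1)]]) simp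
  then have "measure_pmf.expectation ?M (\<lambda>y. \<Prod>i\<in>A. f i (y i)) =
      (\<Prod>i\<in>A. measure_pmf.expectation ?M (\<lambda>y. f i (y i)))"
    using int assms(1) by (intro prob_space.indep_vars_lebesgue_integral[OF prob_space_measure_pmf])
  also have "\<dots> = (\<Prod>i\<in>A. measure_pmf.expectation (p i) (f i))"
    by (rule prod.cong) (simp_all add: comp[symmetric])
  finally show ?thesis .
qed

text \<open>The sign is a product of independent factors, one per point, each -1 if the point lies
  below \<open>v\<close> and 1 otherwise. A uniform leaf lies below \<open>v\<close> with
  probability \<open>1 / b ^ l\<close>, which gives the mean of one factor.\<close>

lemma expectation_parity_sign:
  assumes "2 \<le> b" "v \<in> hst_leaves b l" "l \<le> \<delta>"
  shows "measure_pmf.expectation (random_leaves b \<delta> n)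
      (\<lambda>W. (- 1) ^ card {i\<in>{..<n}. drop (\<delta> - l) (W i) = v}) = (1 - 2 / real b ^ l) ^ n"
proof -
  let ?s = "\<lambda>x. if drop (\<delta> - l) x = v then - 1 else 1 :: real"
  have sign: "(- 1) ^ card {i\<in>{..<n}. drop (\<delta> - l) (W i) = v} = (\<Prod>i<n. ?s (W i))" for W
    by (simp add: prod.If_cases Int_def)
  have "measure_pmf.expectation (pmf_of_set (hst_leaves b \<delta>)) ?s = 1 - 2 / real b ^ l"
  proof -
    have eq: "?s x = 1 - 2 * of_bool (drop (\<delta> - l) x = v)" for x by simp
    have "(\<Sum>x\<in>hst_leaves b \<delta>. ?s x) = real b ^ \<delta> - 2 * real b ^ (\<delta> - l)"
      unfolding eq using card_leaves_below[OF assms(2,3)] finite_hst_leaves[of b \<delta>]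
      by (simp add: sum_subtractf card_hst_leaves sum_distrib_left[symmetric] Int_def)
    moreover have "real b ^ \<delta> = real b ^ (\<delta> - l) * real b ^ l"
      using assms(3) by (simp add: power_add[symmetric])
    ultimately show ?thesis
      using assms(1) hst_leaves_nonempty[OF assms(1), of \<delta>]
      by (subst integral_pmf_of_set) (simp_all add: finite_hst_leaves card_hst_leaves field_simps)
  qed
  then show ?thesis
    unfolding sign random_leaves_def using finite_hst_leaves hst_leaves_nonempty[OF assms(1)]
    by (subst expectation_prod_Pi_pmf_finite) auto
qed

text \<open>Oddness of \<open>k\<close> has the indicator \<open>(1 - (- 1) ^ k) / 2\<close>, so
  linearity reduces level \<open>l\<close> to \<open>b ^ l\<close> equal sign expectations.\<close>

lemma expected_matching_eq:
  assumes "2 \<le> b" "0 \<le> lam"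
  shows "expected_matching b \<delta> lam n = (\<Sum>l=1..\<delta>. lam ^ l *
    (real b ^ l * (1 - (1 - 2 / real b ^ l) ^ n) / 2 - of_bool (odd n)))"
proof -
  let ?M = "random_leaves b \<delta> n"
  define c where "c W l v = card {i\<in>{..<n}. drop (\<delta> - l) (W i) = v}"
    for W :: "nat \<Rightarrow> nat list" and l v
  interpret hierarchical_metric "hst_leaves b \<delta>" "hst_dist b \<delta> lam" "\<lambda>l. drop (\<delta> - l)" "\<lambda>l. lam ^ l" \<delta>
    by (rule hierarchical_metric_hst) fact
  have set_leaves: "set_pmf (pmf_of_set (hst_leaves b \<delta>)) = hst_leaves b \<delta>"
    using finite_hst_leaves hst_leaves_nonempty[OF assms(1)] by simp
  have "finite (set_pmf ?M)"
    unfolding random_leaves_def using finite_hst_leaves set_leaves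
    by (auto simp: set_Pi_pmf intro!: finite_PiE_dflt)
  then have int: "integrable (measure_pmf ?M) f" for f :: "_ \<Rightarrow> real"
    by (rule integrable_measure_pmf_finite)
  have "min_matching (hst_dist b \<delta> lam) {..<n} W =
      (\<Sum>l=1..\<delta>. lam ^ l * ((\<Sum>v\<in>hst_leaves b l. (1 - (- 1) ^ c W l v) / 2) - of_bool (odd n)))"
    if "W \<in> set_pmf ?M" for W
  proof -
    have W: "W ` {..<n} \<subseteq> hst_leaves b \<delta>"
      using that set_leaves by (auto simp: random_leaves_def set_Pi_pmf PiE_dflt_def)
    have "real (card (odd_classes (\<lambda>i. drop (\<delta> - l) (W i)) {..<n})) =
        (\<Sum>v\<in>hst_leaves b l. (1 - (- 1) ^ c W l v) / 2)" if l: "l \<le> \<delta>" for l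
    proof -
      have "odd_classes (\<lambda>i. drop (\<delta> - l) (W i)) {..<n} = {v \<in> hst_leaves b l. odd (c W l v)}"
        using odd_classes_subset[of "\<lambda>i. drop (\<delta> - l) (W i)" "{..<n}"] W drop_hst_leaves[OF _ l]
        by (auto simp: odd_classes_def c_def)
      moreover have "(1 - (- 1) ^ k) / 2 = (of_bool (odd k) :: real)" for k :: nat by simp
      ultimately show ?thesis using finite_hst_leaves[of b l] by (simp add: Int_def)
    qed
    then show ?thesis
      using min_matching_eq_parity_cost[of "{..<n}" W] W by (simp add: parity_cost_def)
  qed
  \<comment> \<open>The closed form holds only for families of leaves, hence the passage to almost
    sure equality.\<close>
  then have "expected_matching b \<delta> lam n = measure_pmf.expectation ?M (\<lambda>W.
      \<Sum>l=1..\<delta>. lam ^ l * ((\<Sum>v\<in>hst_leaves b l. (1 - (- 1) ^ c W l v) / 2) - of_bool (odd n)))"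
    unfolding expected_matching_def by (intro integral_cong_AE) (auto simp: AE_measure_pmf_iff)
  also have "\<dots> = (\<Sum>l=1..\<delta>. lam ^ l *
      ((\<Sum>v\<in>hst_leaves b l. (1 - measure_pmf.expectation ?M (\<lambda>W. (- 1) ^ c W l v)) / 2) - of_bool (odd n)))"
    using int by (simp add: Bochner_Integration.integral_sum)
  also have "\<dots> = (\<Sum>l=1..\<delta>. lam ^ l *
      ((\<Sum>v\<in>hst_leaves b l. (1 - (1 - 2 / real b ^ l) ^ n) / 2) - of_bool (odd n)))"
  proof -
    have "measure_pmf.expectation ?M (\<lambda>W. (- 1) ^ c W l v) = (1 - 2 / real b ^ l) ^ n"
      if "v \<in> hst_leaves b l" "l \<le> \<delta>" for v l
      unfolding c_def by (rule expectation_parity_sign[OF assms(1) that])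
    then have "(\<Sum>v\<in>hst_leaves b l. (1 - measure_pmf.expectation ?M (\<lambda>W. (- 1) ^ c W l v)) / 2) =
        (\<Sum>v\<in>hst_leaves b l. (1 - (1 - 2 / real b ^ l) ^ n) / 2)" if "l \<le> \<delta>" for l
      using that by (intro sum.cong) simp_all
    then show ?thesis by (intro sum.cong) simp_all
  qed
  also have "\<dots> = (\<Sum>l=1..\<delta>. lam ^ l *
      (real b ^ l * (1 - (1 - 2 / real b ^ l) ^ n) / 2 - of_bool (odd n)))"
    by (simp add: card_hst_leaves)
  finally show ?thesis .
qed

lemma hst_sum_eq:
  assumes "2 \<le> b" "1 \<le> n"
  shows "hst_sum b \<delta> lam n = (\<Sum>k\<in>{k\<in>{1..\<delta>}. b ^ k \<le> n}. (real b * lam) ^ k)"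
proof -
  have "real k \<le> log b n \<longleftrightarrow> b ^ k \<le> n" for k
  proof -
    have "real k \<le> log b n \<longleftrightarrow> real b powr real k \<le> real n"
      using assms by (subst le_log_iff) auto
    also have "\<dots> \<longleftrightarrow> real (b ^ k) \<le> real n"
      using assms by (simp add: powr_realpow)
    finally show ?thesis by (simp only: of_nat_le_iff)
  qed
  then have "{k. 1 \<le> k \<and> real k \<le> min (real \<delta>) (log (real b) (real n))} = {k\<in>{1..\<delta>}. b ^ k \<le> n}"
    by auto
  then show ?thesis by (simp add: hst_sum_def Let_def)
qed

subsection \<open>Estimates\<close>

text \<open>The expectation of \<open>O\<^sub>l - (n mod 2)\<close> for \<open>m = b\<^sup>l\<close>.\<close>

definition parity_excess :: "real \<Rightarrow> nat \<Rightarrow> real" where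
  "parity_excess m n = m * (1 - (1 - 2 / m) ^ n) / 2 - of_bool (odd n)"

text \<open>For odd \<open>n\<close> compare the power with its base, which lies between 0 and 1:
  the main term is then at least 1.\<close>

lemma parity_excess_nonneg:
  assumes "2 \<le> m"
  shows "0 \<le> parity_excess m n"
proof (cases "odd n")
  case True
  have "(1 - 2 / m) ^ n \<le> (1 - 2 / m) ^ 1"
    using True assms by (intro power_decreasing) (auto simp: odd_pos Suc_leI)
  then have "m * (1 - (1 - 2 / m) ^ n) \<ge> m * (2 / m)"
    using assms by (intro mult_left_mono) auto
  then show ?thesis using True assms by (simp add: parity_excess_def)
next
  case False
  then show ?thesis using assms by (simp add: parity_excess_def power_le_one)
qed

lemma parity_excess_le_half:
  assumes "2 \<le> m"
  shows "parity_excess m n \<le> m / 2"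
proof -
  have "m * (1 - (1 - 2 / m) ^ n) \<le> m * 1"
    using assms by (intro mult_left_mono) auto
  then show ?thesis by (simp add: parity_excess_def)
qed

text \<open>Bernoulli's inequality. This bound is the useful one at levels with more than
  \<open>n\<close> vertices.\<close>

lemma parity_excess_le:
  assumes "2 \<le> m"
  shows "parity_excess m n \<le> n"
proof -
  have "1 + real n * (- 2 / m) \<le> (1 + (- 2 / m)) ^ n"
    using assms by (intro Bernoulli_inequality) (simp add: field_simps)
  then have "m * (1 - (1 - 2 / m) ^ n) \<le> m * (real n * 2 / m)"
    using assms by (intro mult_left_mono) auto
  then show ?thesis using assms by (simp add: parity_excess_def)
qed

text \<open>The power is at most \<open>exp (- 2)\<close>, hence at most 1/4, so the main term is at
  least \<open>3 * m / 8\<close>. The correction is at most \<open>m / 3\<close>, and 3/8 - 1/3 =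
  1/24.\<close>

lemma parity_excess_ge:
  assumes "2 \<le> m" "m \<le> n" "even n \<or> 3 \<le> m"
  shows "m / 24 \<le> parity_excess m n"
proof -
  have "(1 - 2 / m) ^ n \<le> exp (- 2 / m) ^ n"
    using assms exp_ge_add_one_self[of "- 2 / m"] by (intro power_mono) auto
  also have "\<dots> = exp (- (2 * (n / m)))"
    by (simp add: exp_of_nat_mult[symmetric] field_simps)
  also have "\<dots> \<le> exp (- 2)" using assms by (simp add: field_simps)
  also have "\<dots> \<le> 1 / 4"
  proof -
    have "(2 :: real) ^ 2 \<le> exp 1 ^ 2"
      using exp_ge_add_one_self[of 1] by (intro power_mono) auto
    then have "4 \<le> exp (2 :: real)" by (simp add: exp_double[symmetric])
    then show ?thesis by (simp add: exp_minus field_simps)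
  qed
  finally have "m * (1 - (1 - 2 / m) ^ n) \<ge> m * (3 / 4)"
    using assms by (intro mult_left_mono) auto
  moreover have "of_bool (odd n) \<le> m / 3" using assms by auto
  ultimately show ?thesis unfolding parity_excess_def by linarith
qed

text \<open>Serves level 2 of a binary tree, including \<open>n = 3\<close>, where
  \<open>m \<le> n\<close> fails.\<close>

lemma parity_excess_4:
  assumes "odd n" "3 \<le> n"
  shows "3 / 4 \<le> parity_excess 4 n"
proof -
  have "(1 / 2 :: real) ^ n \<le> (1 / 2) ^ 3" using assms by (intro power_decreasing) auto
  then show ?thesis using assms by (simp add: parity_excess_def power3_eq_cube)
qed

section \<open>Upper and lower bounds on the expected cost\<close>

lemma expected_matching_eq_parity_excess:
  assumes "2 \<le> b" "0 \<le> lam"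
  shows "expected_matching b \<delta> lam n = (\<Sum>l=1..\<delta>. lam ^ l * parity_excess (real b ^ l) n)"
  using expected_matching_eq[OF assms] by (simp add: parity_excess_def)

lemma two_le_power:
  assumes "2 \<le> b" "1 \<le> l"
  shows "2 \<le> real b ^ l"
proof -
  have "2 \<le> b ^ l" using self_le_power[of b l] assms by simp
  then have "real 2 \<le> real (b ^ l)" by (simp only: of_nat_le_iff)
  then show ?thesis by simp
qed

text \<open>Each level with \<open>b ^ k \<le> n\<close> contributes at least 1/24 of its term of
  the sum, except level 1 for \<open>b = 2\<close> and odd \<open>n\<close>. The smaller factor
  \<open>lam / 48\<close> leaves room to pay for that term.\<close>

lemma expected_matching_lower:
  assumes b: "2 \<le> b" and lam: "0 < lam" "lam < 1" and n: "1 \<le> n"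
    and nondegenerate: "\<not> (b = 2 \<and> \<delta> = 1 \<and> odd n \<and> 3 \<le> n)" and "1 \<le> \<delta>"
  shows "lam / 48 * hst_sum b \<delta> lam n \<le> expected_matching b \<delta> lam n"
proof -
  define K where "K = {k\<in>{1..\<delta>}. b ^ k \<le> n}"
  define E where "E = expected_matching b \<delta> lam n"
  have sum: "hst_sum b \<delta> lam n = (\<Sum>k\<in>K. (real b * lam) ^ k)"
    unfolding K_def by (rule hst_sum_eq[OF b n])
  have E: "E = (\<Sum>l=1..\<delta>. lam ^ l * parity_excess (real b ^ l) n)"
    unfolding E_def using b lam by (intro expected_matching_eq_parity_excess) auto
  \<comment> \<open>All levels contribute nonnegatively, so any subset of them bounds
    \<open>E\<close> from below.\<close>
  have part: "(\<Sum>l\<in>J. lam ^ l * parity_excess (real b ^ l) n) \<le> E" if "J \<subseteq> {1..\<delta>}" for J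
    unfolding E using that lam b
    by (intro sum_mono2) (auto intro!: mult_nonneg_nonneg parity_excess_nonneg two_le_power)
  have bound: "(\<Sum>k\<in>J. (real b * lam) ^ k) / 24 \<le> E"
    if J: "J \<subseteq> K" "\<And>k. k \<in> J \<Longrightarrow> even n \<or> 3 \<le> b ^ k" for J
  proof -
    have "(\<Sum>k\<in>J. (real b * lam) ^ k) / 24 = (\<Sum>k\<in>J. lam ^ k * (real b ^ k / 24))"
      by (simp add: sum_divide_distrib power_mult_distrib mult.commute)
    also have "\<dots> \<le> (\<Sum>k\<in>J. lam ^ k * parity_excess (real b ^ k) n)"
    proof (intro sum_mono mult_left_mono parity_excess_ge)
      fix k assume k: "k \<in> J"
      then show "2 \<le> real b ^ k" using J(1) b by (auto simp: K_def intro!: two_le_power)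
      have "real (b ^ k) \<le> real n" using k J(1) by (auto simp: K_def simp del: of_nat_power)
      then show "real b ^ k \<le> real n" by simp
      have "even n \<or> real 3 \<le> real (b ^ k)" using J(2)[OF k] of_nat_le_iff by blast
      then show "even n \<or> 3 \<le> real b ^ k" by simp
    qed (use lam in auto)
    also have "\<dots> \<le> E" using J(1) by (intro part) (auto simp: K_def)
    finally show ?thesis .
  qed
  have nonneg: "0 \<le> (\<Sum>k\<in>J. (real b * lam) ^ k)" for J using lam by (intro sum_nonneg) auto
  have small: "lam * (\<Sum>k\<in>J. (real b * lam) ^ k) \<le> (\<Sum>k\<in>J. (real b * lam) ^ k)" for J
    using lam nonneg by (intro mult_left_le_one_le) auto
  show ?thesis
  proof (cases "b = 2 \<and> odd n")
    case False
    have "3 \<le> b ^ k" if "k \<in> K" "b \<noteq> 2" for k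
      using self_le_power[of b k] that b by (auto simp: K_def)
    then have "(\<Sum>k\<in>K. (real b * lam) ^ k) / 24 \<le> E" using False by (intro bound) auto
    then show ?thesis using small[of K] nonneg[of K] by (simp add: sum E_def)
  next
    case True
    \<comment> \<open>Level 1 contributes nothing here, so its term of the sum is charged to level 2.\<close>
    show ?thesis
    proof (cases "n = 1")
      case n1: True
      have "k \<notin> K" for k using self_le_power[of b k] b n1 by (auto simp: K_def)
      then have "K = {}" by blast
      then show ?thesis using part[of "{}"] by (simp add: sum E_def)
    next
      case False
      then have n3: "3 \<le> n" using True n by presburger
      then have "2 \<le> \<delta>" using nondegenerate True \<open>1 \<le> \<delta>\<close> by auto
      let ?T = "\<Sum>k\<in>K - {1}. (real b * lam) ^ k"
      have "?T / 24 \<le> E"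
      proof (rule bound)
        fix k assume "k \<in> K - {1}"
        then have "(2 :: nat) ^ 2 \<le> 2 ^ k" by (intro power_increasing) (auto simp: K_def)
        then show "even n \<or> 3 \<le> b ^ k" using True by simp
      qed auto
      moreover have "lam ^ 2 * (3 / 4) \<le> E"
      proof -
        have "lam ^ 2 * (3 / 4) \<le> lam ^ 2 * parity_excess 4 n"
          using parity_excess_4[of n] True n3 lam by (intro mult_left_mono) auto
        also have "\<dots> \<le> E" using part[of "{2}"] True \<open>2 \<le> \<delta>\<close> by simp
        finally show ?thesis .
      qed
      moreover have "1 \<in> K" using True n3 \<open>1 \<le> \<delta>\<close> by (simp add: K_def)
      then have "(\<Sum>k\<in>K. (real b * lam) ^ k) = 2 * lam + ?T"
        using True by (subst sum.remove[of _ 1]) (auto simp: K_def)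
      \<comment> \<open>The first summand is at most \<open>E / 18\<close> by the level-2 bound, the
        second at most \<open>E / 2\<close> by the bound on \<open>?T\<close>.\<close>
      then have "lam / 48 * hst_sum b \<delta> lam n = lam ^ 2 / 24 + lam * ?T / 48"
        by (simp add: sum power2_eq_square algebra_simps)
      moreover have "0 \<le> lam ^ 2" by simp
      ultimately show ?thesis using small[of "K - {1}"] unfolding E_def by linarith
    qed
  qed
qed

text \<open>Levels in \<open>K\<close> cost at most their own term of the sum. Levels in
  \<open>R\<close> cost at most \<open>n * lam ^ l\<close>, a geometric tail dominated by the last
  term indexed by \<open>K\<close>.\<close>

lemma expected_matching_upper:
  assumes b: "2 \<le> b" and lam: "0 < lam" "lam < 1" and n: "1 \<le> n" "\<not> (2 \<le> n \<and> n < b)"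
  shows "expected_matching b \<delta> lam n \<le> (1 + real b * lam / (1 - lam)) * hst_sum b \<delta> lam n"
proof -
  define K where "K = {k\<in>{1..\<delta>}. b ^ k \<le> n}"
  define R where "R = {k\<in>{1..\<delta>}. n < b ^ k}"
  define S where "S = (\<Sum>k\<in>K. (real b * lam) ^ k)"
  define E where "E = expected_matching b \<delta> lam n"
  have sum: "hst_sum b \<delta> lam n = S"
    unfolding K_def S_def by (rule hst_sum_eq[OF b n(1)])
  have E: "E = (\<Sum>l=1..\<delta>. lam ^ l * parity_excess (real b ^ l) n)"
    unfolding E_def using b lam by (intro expected_matching_eq_parity_excess) auto
  have S0: "0 \<le> S" unfolding S_def using lam by (intro sum_nonneg) auto
  have c0: "0 \<le> real b * lam / (1 - lam)" using lam by simp
  show ?thesis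
  proof (cases "n = 1")
    case True
    \<comment> \<open>A single point is discarded at no cost: the main term of the excess is exactly
      1.\<close>
    have "E = 0" unfolding E using True b by (intro sum.neutral) (auto simp: parity_excess_def)
    then show ?thesis using S0 c0 by (simp add: sum E_def)
  next
    case False
    then have "b \<le> n" using n by auto
    have "{1..\<delta>} = K \<union> R" "K \<inter> R = {}" "finite K" "finite R" by (auto simp: K_def R_def)
    then have "E = (\<Sum>l\<in>K. lam ^ l * parity_excess (real b ^ l) n) + (\<Sum>l\<in>R. lam ^ l * parity_excess (real b ^ l) n)"
      unfolding E by (simp add: sum.union_disjoint)
    moreover have "(\<Sum>l\<in>K. lam ^ l * parity_excess (real b ^ l) n) \<le> S"
      unfolding S_def
    proof (rule sum_mono)
      fix l assume "l \<in> K"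
      then have "parity_excess (real b ^ l) n \<le> real b ^ l"
        using parity_excess_le_half[of "real b ^ l" n] two_le_power[OF b, of l] by (auto simp: K_def)
      then show "lam ^ l * parity_excess (real b ^ l) n \<le> (real b * lam) ^ l"
        using lam by (simp add: power_mult_distrib mult.commute)
    qed
    moreover have "(\<Sum>l\<in>R. lam ^ l * parity_excess (real b ^ l) n) \<le> real b * lam / (1 - lam) * S"
    proof (cases "R = {}")
      case True
      then show ?thesis using mult_nonneg_nonneg[OF c0 S0] by simp
    next
      case False
      obtain L where L: "b ^ L \<le> n" "n < b ^ (L + 1)" using ex_power_ivl1[of b n] b n by blast
      have "L < k" if "k \<in> R" for k
      proof -
        have "b ^ L < b ^ k" using that L by (simp add: R_def)
        then show ?thesis using b by (simp add: power_strict_increasing_iff)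
      qed
      then have R: "R \<subseteq> {L+1..\<delta>}" by (auto simp: R_def Suc_le_eq)
      \<comment> \<open>The last level with at most \<open>n\<close> vertices belongs to
        \<open>K\<close>: it is at least 1 because \<open>b \<le> n\<close>, and below
        \<open>\<delta>\<close> because \<open>R\<close> is nonempty.\<close>
      have "L \<noteq> 0" using L(2) \<open>b \<le> n\<close> by (intro notI) simp
      moreover have "L < \<delta>" using False R by auto
      ultimately have "L \<in> K" using L by (auto simp: K_def)
      have "(\<Sum>l\<in>R. lam ^ l * parity_excess (real b ^ l) n) \<le> (\<Sum>l\<in>R. lam ^ l * n)"
        using lam b
        by (intro sum_mono mult_left_mono parity_excess_le two_le_power) (auto simp: R_def)
      also have "\<dots> \<le> (\<Sum>l=L+1..\<delta>. lam ^ l * n)"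
        using R lam by (intro sum_mono2) auto
      also have "\<dots> = n * (\<Sum>l=L+1..\<delta>. lam ^ l)" by (simp add: sum_distrib_left mult.commute)
      also have "\<dots> \<le> real (b ^ (L + 1)) * (lam ^ (L + 1) / (1 - lam))"
      proof (rule mult_mono)
        have "(1 - lam) * (\<Sum>l=L+1..\<delta>. lam ^ l) \<le> lam ^ (L + 1)"
          using sum_gp_multiplied[of "L + 1" \<delta> lam] \<open>L < \<delta>\<close> lam by simp
        then show "(\<Sum>l=L+1..\<delta>. lam ^ l) \<le> lam ^ (L + 1) / (1 - lam)"
          using lam by (simp add: field_simps)
        show "real n \<le> real (b ^ (L + 1))" using L(2) by (simp only: of_nat_le_iff less_imp_le)
      qed (use lam in \<open>auto intro!: sum_nonneg\<close>)
      \<comment> \<open>The level \<open>L + 1\<close> exceeds \<open>L\<close> by one, which costs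
        the factor \<open>b * lam\<close>; the remaining power is a term of
        \<open>S\<close>.\<close>
      also have "\<dots> = real b * lam / (1 - lam) * (real b * lam) ^ L"
        by (simp add: power_mult_distrib)
      also have "\<dots> \<le> real b * lam / (1 - lam) * S"
        unfolding S_def using c0 \<open>L \<in> K\<close> lam \<open>finite K\<close>
        by (intro mult_left_mono member_le_sum) auto
      finally show ?thesis .
    qed
    ultimately show ?thesis by (simp add: sum E_def algebra_simps)
  qed
qed

theorem theorem4:
  fixes b :: nat and lam :: real
  assumes "2 \<le> b" and "0 < lam" and "lam < 1"
  shows "\<exists>A B :: real. 0 < A \<and> 0 < B \<and>
    (\<forall>\<delta> n :: nat. 1 \<le> \<delta> \<longrightarrow> 1 \<le> n \<longrightarrow>
       (\<not> (b = 2 \<and> \<delta> = 1 \<and> odd n \<and> 3 \<le> n) \<longrightarrow>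
          A * hst_sum b \<delta> lam n \<le> expected_matching b \<delta> lam n) \<and>
       (\<not> (2 \<le> n \<and> n < b) \<longrightarrow>
          expected_matching b \<delta> lam n \<le> B * hst_sum b \<delta> lam n))"
proof (intro exI conjI allI impI)
  \<comment> \<open>Both witnesses are chosen before \<open>\<delta>\<close> and \<open>n\<close>
    and involve only \<open>b\<close> and \<open>lam\<close>.\<close>
  show "0 < lam / 48" using assms by simp
  show "0 < 1 + real b * lam / (1 - lam)" using assms by (simp add: add_pos_nonneg)
qed (use assms expected_matching_lower expected_matching_upper in blast)+

end
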